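(* Let $(G,P,\theta)$ be an algebraic dynamical system and $S=G\rtimes_\theta P$. Suppose that for every foundation set $F$ for $P$ with $F\subset P^{(\mathrm{fin})}$ there exists an accurate foundation set $F_a$ for $P$ which refines $F$ and satisfies $F_a\subset P^{(\mathrm{fin})}$. Then every foundation set for $S$ can be refined accurately by an elementary foundation set for $S$; that is, for every foundation set $F$ for $S$ there is an elementary foundation set $F_e$ such that every $f_e\in F_e$ lies in $fS$ for some $f\in F$. In particular, $S$ has property (AR).
   Context: All semigroups are countable, discrete and left cancellative. A semigroup is right LCM if the intersection of two principal right ideals is either empty or again a principal right ideal. An algebraic dynamical system $(G,P,\theta)$ is an action $\theta$ of a right LCM semigroup $P$ with identity by injective endomorphisms of a group $G$ (so $\theta_p\theta_q=\theta_{pq}$, $\theta_1=\mathrm{id}$) such that $pP\cap qP=rP$ implies $\theta_p(G)\cap\theta_q(G)=\theta_r(G)$ for all $p,q,r\in P$. $G\rtimes_\theta P$ is the set $G\times P$ with product $(g,p)(h,q)=(g\theta_p(h),pq)$; it is a right LCM semigroup with identity. $P^{(\mathrm{fin})}$ is the subsemigroup of those $p\in P$ for which $G/\theta_p(G)$ is finite. For a right LCM semigroup $T$ with identity: a finite subset $F\subset T$ is a foundation set for $T$ if for every $s\in T$ there is $t\in F$ with $sT\cap tT\neq\emptyset$. A foundation set $F$ is accurate if $sT\cap tT=\emptyset$ for all distinct $s,t\in F$. A set $F_a$ refines $F$ if every $f_a\in F_a$ lies in $fT$ for some $f\in F$. $T$ has the accurate refinement property, property (AR), if every foundation set is refined by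 some accurate foundation set. An elementary foundation set for $S=G\rtimes_\theta P$ is a finite set $F=\{(g_\ell^{(k)},p_\ell)\mid 1\leq\ell\leq m,\ 1\leq k\leq n_\ell\}\subset S$ such that $\{p_1,\dots,p_m\}\subset P^{(\mathrm{fin})}$ is an accurate foundation set for $P$, and for each $1\le\ell\le m$ the family $(g_\ell^{(k)})_{1\leq k\leq n_\ell}$ is a transversal for $G/\theta_{p_\ell}(G)$. Every elementary foundation set is an accurate foundation set for $S$. *)

theory Defs
  imports "HOL-Algebra.Left_Coset" "HOL-Library.Countable_Set"
begin

text \<open>The principal right ideal \<open>s T\<close> is the coset \<open>s <#\<^bsub>T\<^esub> carrier T\<close>. Since all semigroups
  below have an identity, it contains \<open>s\<close>.\<close>

abbreviation principal_right_ideal :: "('a, 'b) monoid_scheme \<Rightarrow> 'a \<Rightarrow> 'a set" where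
  "principal_right_ideal T s \<equiv> s <#\<^bsub>T\<^esub> carrier T"

locale right_lcm_monoid = monoid T for T (structure) +
  assumes countable_carrier: "countable (carrier T)"
    and left_cancel:
      "\<lbrakk>a \<in> carrier T; b \<in> carrier T; c \<in> carrier T; a \<otimes> b = a \<otimes> c\<rbrakk> \<Longrightarrow> b = c"
    and right_lcm:
      "\<lbrakk>p \<in> carrier T; q \<in> carrier T\<rbrakk> \<Longrightarrow>
        principal_right_ideal T p \<inter> principal_right_ideal T q = {} \<or>
        (\<exists>r\<in>carrier T. principal_right_ideal T p \<inter> principal_right_ideal T q
                         = principal_right_ideal T r)"

definition foundation_set :: "('a, 'b) monoid_scheme \<Rightarrow> 'a set \<Rightarrow> bool" where
  "foundation_set T F \<longleftrightarrow>
     finite F \<and> F \<subseteq> carrier T \<and>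
     (\<forall>s\<in>carrier T. \<exists>t\<in>F. principal_right_ideal T s \<inter> principal_right_ideal T t \<noteq> {})"

definition accurate_foundation_set :: "('a, 'b) monoid_scheme \<Rightarrow> 'a set \<Rightarrow> bool" where
  "accurate_foundation_set T F \<longleftrightarrow>
     foundation_set T F \<and>
     (\<forall>s\<in>F. \<forall>t\<in>F. s \<noteq> t \<longrightarrow> principal_right_ideal T s \<inter> principal_right_ideal T t = {})"

definition refines :: "('a, 'b) monoid_scheme \<Rightarrow> 'a set \<Rightarrow> 'a set \<Rightarrow> bool" where
  "refines T F\<^sub>a F \<longleftrightarrow> (\<forall>f\<^sub>a\<in>F\<^sub>a. \<exists>f\<in>F. f\<^sub>a \<in> principal_right_ideal T f)"

definition property_AR :: "('a, 'b) monoid_scheme \<Rightarrow> bool" where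
  "property_AR T \<longleftrightarrow>
     (\<forall>F. foundation_set T F \<longrightarrow> (\<exists>F\<^sub>a. accurate_foundation_set T F\<^sub>a \<and> refines T F\<^sub>a F))"

locale algebraic_dynamical_system =
  G: group G + P: right_lcm_monoid P
  for G :: "('g, 'm) monoid_scheme" and P :: "('p, 'n) monoid_scheme"
    and \<theta> :: "'p \<Rightarrow> 'g \<Rightarrow> 'g" +
  assumes countable_group: "countable (carrier G)"
    and endomorphism: "p \<in> carrier P \<Longrightarrow> \<theta> p \<in> hom G G"
    and injective: "p \<in> carrier P \<Longrightarrow> inj_on (\<theta> p) (carrier G)"
    and action_mult:
      "\<lbrakk>p \<in> carrier P; q \<in> carrier P; g \<in> carrier G\<rbrakk> \<Longrightarrow> \<theta> p (\<theta> q g) = \<theta> (p \<otimes>\<^bsub>P\<^esub> q) g"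
    and action_one: "g \<in> carrier G \<Longrightarrow> \<theta> \<one>\<^bsub>P\<^esub> g = g"
    and preserves_order:
      "\<lbrakk>p \<in> carrier P; q \<in> carrier P; r \<in> carrier P;
        principal_right_ideal P p \<inter> principal_right_ideal P q = principal_right_ideal P r\<rbrakk> \<Longrightarrow>
        \<theta> p ` carrier G \<inter> \<theta> q ` carrier G = \<theta> r ` carrier G"

definition semidirect_product ::
  "('g, 'm) monoid_scheme \<Rightarrow> ('p, 'n) monoid_scheme \<Rightarrow> ('p \<Rightarrow> 'g \<Rightarrow> 'g) \<Rightarrow> ('g \<times> 'p) monoid" where
  "semidirect_product G P \<theta> =
     \<lparr>carrier = carrier G \<times> carrier P,
      mult = (\<lambda>(g, p) (h, q). (g \<otimes>\<^bsub>G\<^esub> \<theta> p h, p \<otimes>\<^bsub>P\<^esub> q)),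
      one = (\<one>\<^bsub>G\<^esub>, \<one>\<^bsub>P\<^esub>)\<rparr>"

text \<open>The subgroup \<open>\<theta> p (G)\<close> need not be normal, so \<open>G / \<theta> p (G)\<close> is the set of left cosets;
  left is the side for which \<open>(g, p) S = g \<theta> p (G) \<times> p P\<close>.\<close>

definition P_fin ::
  "('g, 'm) monoid_scheme \<Rightarrow> ('p, 'n) monoid_scheme \<Rightarrow> ('p \<Rightarrow> 'g \<Rightarrow> 'g) \<Rightarrow> 'p set" where
  "P_fin G P \<theta> = {p \<in> carrier P. finite (lcosets\<^bsub>G\<^esub> (\<theta> p ` carrier G))}"

text \<open>A family, rather than a set, of representatives: no coset is hit twice.\<close>

definition transversal_family ::
  "('g, 'm) monoid_scheme \<Rightarrow> 'g set \<Rightarrow> 'i set \<Rightarrow> ('i \<Rightarrow> 'g) \<Rightarrow> bool" where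
  "transversal_family G H I g \<longleftrightarrow>
     (\<forall>i\<in>I. g i \<in> carrier G) \<and> bij_betw (\<lambda>i. g i <#\<^bsub>G\<^esub> H) I (lcosets\<^bsub>G\<^esub> H)"

text \<open>Here \<open>g l k\<close> is the representative with lower index \<open>l\<close> and upper index \<open>k\<close>.
  The \<open>p l\<close> are pairwise distinct: if \<open>p\<^sub>1 = p\<^sub>2\<close> were allowed to carry two different
  transversals, the resulting set would not be accurate.\<close>

definition elementary_foundation_set ::
  "('g, 'm) monoid_scheme \<Rightarrow> ('p, 'n) monoid_scheme \<Rightarrow> ('p \<Rightarrow> 'g \<Rightarrow> 'g) \<Rightarrow> ('g \<times> 'p) set \<Rightarrow> bool"
where
  "elementary_foundation_set G P \<theta> F \<longleftrightarrow>
     (\<exists>(m :: nat) (n :: nat \<Rightarrow> nat) (g :: nat \<Rightarrow> nat \<Rightarrow> 'g) (p :: nat \<Rightarrow> 'p).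
        F = {(g l k, p l) | l k. l \<in> {1..m} \<and> k \<in> {1..n l}} \<and>
        inj_on p {1..m} \<and>
        p ` {1..m} \<subseteq> P_fin G P \<theta> \<and>
        accurate_foundation_set P (p ` {1..m}) \<and>
        (\<forall>l\<in>{1..m}. transversal_family G (\<theta> (p l) ` carrier G) {1..n l} (g l)))"

end

theory Submission
  imports Defs
begin

text \<open>Since \<open>(g, p) S = g \<theta>\<^sub>p(G) \<times> p P\<close>, each \<open>p\<close> can be pushed down to some \<open>p' \<in> p P\<close> that, for every
  \<open>(h, q)\<close> in the given foundation set, either lies in \<open>q P\<close> or has \<open>p' P\<close> disjoint from \<open>q P\<close>;
  then \<open>G\<close> is covered by the cosets \<open>h \<theta>\<^sub>q(G)\<close> with \<open>p' \<in> q P\<close>. By B. H. Neumann's lemma the cosets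
  of finite index alone cover \<open>G\<close>. Hence the least common multiples of those finite families of
  \<open>q \<in> P\<^sup>f\<^sup>i\<^sup>n\<close> whose cosets cover \<open>G\<close> form a foundation set for \<open>P\<close>, and any transversals over an accurate
  refinement of it inside \<open>P\<^sup>f\<^sup>i\<^sup>n\<close> give the elementary foundation set.\<close>

section \<open>Subgroups of finite index and Neumann's lemma on coverings by cosets\<close>

lemma (in group) finite_lcosets_Int:
  assumes "finite (lcosets H)" "finite (lcosets K)" "subgroup H G" "subgroup K G"
  shows "finite (lcosets (H \<inter> K))"
proof -
  \<comment> \<open>Left multiplication by \<open>a\<close> is injective, so it commutes with
    intersections. A coset of \<open>H \<inter> K\<close> is therefore determined by a pair of
    cosets, and there are finitely many pairs.\<close>
  have "a <# (H \<inter> K) = (a <# H) \<inter> (a <# K)" if "a \<in> carrier G" for a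
    using inj_on_image_Int[OF inj_on_cmult[OF that]] assms(3,4)[THEN subgroup.subset]
    by (simp add: l_coset_def UNION_singleton_eq_range)
  then have "lcosets (H \<inter> K) \<subseteq> (\<lambda>(X, Y). X \<inter> Y) ` ((lcosets H) \<times> (lcosets K))"
    by (auto simp: LCOSETS_def image_iff)
  then show ?thesis
    using assms(1,2) by (meson finite_SigmaI finite_imageI finite_subset)
qed

text \<open>The factor \<open>carrier G\<close> makes the intersection of the empty family the whole
  group, which has index one.\<close>

lemma (in group) finite_lcosets_Inter:
  assumes "finite HH" "\<And>H. H \<in> HH \<Longrightarrow> subgroup H G \<and> finite (lcosets H)"
  shows "subgroup (carrier G \<inter> \<Inter>HH) G \<and> finite (lcosets (carrier G \<inter> \<Inter>HH))"
  using assms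
proof (induction HH rule: finite_induct)
  case empty
  have "a <# carrier G = carrier G" if "a \<in> carrier G" for a
    using coset_join3 subgroup_self that by blast
  then have "lcosets (carrier G) \<subseteq> {carrier G}"
    by (auto simp: LCOSETS_def)
  then show ?case
    using subgroup_self by (auto intro: finite_subset)
next
  case (insert H HH)
  have "carrier G \<inter> \<Inter>(insert H HH) = H \<inter> (carrier G \<inter> \<Inter>HH)" by auto
  with insert finite_lcosets_Int subgroups_Inter_pair show ?case
    by (metis insertCI)
qed

lemma (in group) lcosets_transversal:
  assumes "finite (lcosets H)" "subgroup H G"
  obtains R where "finite R" "R \<subseteq> carrier G" "carrier G \<subseteq> (\<Union>r\<in>R. r <# H)"
proof -
  obtain R where R: "R \<subseteq> carrier G" "finite R" "lcosets H = (\<lambda>a. a <# H) ` R"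
    using finite_subset_image[OF assms(1), of "\<lambda>a. a <# H" "carrier G"]
    unfolding LCOSETS_def UNION_singleton_eq_range by blast
  then show ?thesis
    using that[of R] lcosets_part_G[OF assms(2)] by auto
qed

text \<open>Induction on the number of subgroups. Some coset \<open>x <# H\<close> has no
  representative in the finite set \<open>A\<close>, so the cosets of the other subgroups must cover
  it. Translating that covering replaces every \<open>b <# H\<close> by finitely many cosets of the
  other subgroups, which eliminates \<open>H\<close>. One set \<open>A\<close> of representatives
  serves all subgroups; it grows in the process, hence \<open>arbitrary: A\<close>.\<close>

lemma (in group) infinite_index_not_cover:
  assumes "finite HH" "\<And>H. H \<in> HH \<Longrightarrow> subgroup H G \<and> infinite (lcosets H)"
    and "finite A" "A \<subseteq> carrier G"
  shows "\<not> carrier G \<subseteq> (\<Union>H\<in>HH. \<Union>a\<in>A. a <# H)"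
  using assms
proof (induction HH arbitrary: A rule: finite_induct)
  case empty
  then show ?case by auto
next
  case (insert H HH)
  have H: "subgroup H G" "infinite (lcosets H)"
    using insert.prems by auto
  show ?case
  proof
    assume cover: "carrier G \<subseteq> (\<Union>H\<in>insert H HH. \<Union>a\<in>A. a <# H)"
    have "\<not> lcosets H \<subseteq> (\<lambda>a. a <# H) ` A"
      using H insert.prems(2) finite_surj by blast
    then obtain x where x: "x \<in> carrier G" "x <# H \<notin> (\<lambda>a. a <# H) ` A"
      by (auto simp: LCOSETS_def)
    \<comment> \<open>Left multiplication by \<open>b \<otimes> inv x\<close> carries
      \<open>x <# H\<close> onto \<open>b <# H\<close>, and so carries a covering of the former to
      one of the latter.\<close>
    define A' where "A' = A \<union> (\<lambda>(b, a). b \<otimes> inv x \<otimes> a) ` (A \<times> A)"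
    have A': "finite A'" "A' \<subseteq> carrier G"
      using insert.prems x by (auto simp: A'_def)
    have "carrier G \<subseteq> (\<Union>H\<in>HH. \<Union>a\<in>A'. a <# H)"
    proof
      fix g assume g: "g \<in> carrier G"
      with cover consider (HH) K a where "K \<in> HH" "a \<in> A" "g \<in> a <# K"
        | (H) b where "b \<in> A" "g \<in> b <# H"
        by auto
      then show "g \<in> (\<Union>H\<in>HH. \<Union>a\<in>A'. a <# H)"
      proof cases
        case HH
        then show ?thesis by (auto simp: A'_def)
      next
        case (H b)
        then obtain h where h: "h \<in> H" "g = b \<otimes> h" by (auto simp: l_coset_def)
        have hc: "h \<in> carrier G" using h \<open>subgroup H G\<close> subgroup.mem_carrier by metis
        have xh: "x \<otimes> h \<in> x <# H" using h by (auto simp: l_coset_def)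
        \<comment> \<open>Cosets of \<open>H\<close> with a common point coincide, and
          \<open>x <# H\<close> was chosen different from every \<open>a <# H\<close> with
          \<open>a \<in> A\<close>.\<close>
        have "x \<otimes> h \<notin> a <# H" if "a \<in> A" for a
          using l_repr_independence[OF xh x(1) \<open>subgroup H G\<close>] that
            l_repr_independence[of "x \<otimes> h" a H] \<open>subgroup H G\<close> x(2) insert.prems(3) by blast
        moreover have "x \<otimes> h \<in> carrier G" using x hc by auto
        ultimately obtain K a where K: "K \<in> HH" "a \<in> A" "x \<otimes> h \<in> a <# K"
          using cover by auto
        then obtain k where k: "k \<in> K" "x \<otimes> h = a \<otimes> k" by (auto simp: l_coset_def)
        have c: "a \<in> carrier G" "b \<in> carrier G" "k \<in> carrier G"
          using K k H insert.prems(1,3) subgroup.mem_carrier[of K G k] by auto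
        have "g = b \<otimes> inv x \<otimes> (x \<otimes> h)"
          using h(2) c hc x(1) by (metis inv_closed inv_solve_left m_assoc m_closed)
        also have "\<dots> = (b \<otimes> inv x \<otimes> a) \<otimes> k"
          using k(2) c x(1) by (simp add: m_assoc)
        finally have "g \<in> (b \<otimes> inv x \<otimes> a) <# K"
          using k(1) by (auto simp: l_coset_def)
        moreover have "b \<otimes> inv x \<otimes> a \<in> A'"
          using K(2) H(1) by (auto simp: A'_def)
        ultimately show ?thesis using K(1) by blast
      qed
    qed
    then show False
      using insert.IH[OF _ A'] insert.prems(1) by blast
  qed
qed

text \<open>Suppose that \<open>g\<close> is missed by the cosets of finite index, and let
  \<open>K\<close> be the intersection of the finite-index subgroups that occur. Then these cosets
  miss all of \<open>g <# K\<close>, which is thus covered by cosets of infinite index. Since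
  \<open>K\<close> has finite index, finitely many translates of \<open>g <# K\<close> cover the
  group, contrary to \<open>infinite_index_not_cover\<close>.\<close>

lemma (in group) neumann_coset_cover:
  assumes "finite C" "\<And>a H. (a, H) \<in> C \<Longrightarrow> a \<in> carrier G \<and> subgroup H G"
    and cover: "carrier G \<subseteq> (\<Union>(a, H)\<in>C. a <# H)"
  shows "carrier G \<subseteq> (\<Union>(a, H)\<in>{(a, H) \<in> C. finite (lcosets H)}. a <# H)"
proof
  fix g assume g: "g \<in> carrier G"
  show "g \<in> (\<Union>(a, H)\<in>{(a, H) \<in> C. finite (lcosets H)}. a <# H)"
  proof (rule ccontr)
    assume contra: "\<not> ?thesis"
    define K where "K = carrier G \<inter> \<Inter>{H \<in> snd ` C. finite (lcosets H)}"
    have K: "subgroup K G \<and> finite (lcosets K)"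
      unfolding K_def by (rule finite_lcosets_Inter) (use assms in auto)
    then obtain R where R: "finite R" "R \<subseteq> carrier G" "carrier G \<subseteq> (\<Union>r\<in>R. r <# K)"
      using lcosets_transversal by metis
    \<comment> \<open>The factor \<open>r \<otimes> inv g\<close> carries \<open>g <# K\<close> onto
      \<open>r <# K\<close>, so \<open>A\<close> holds the representatives of the translated
      cosets.\<close>
    define A where "A = (\<lambda>(r, a). r \<otimes> inv g \<otimes> a) ` (R \<times> fst ` C)"
    have "A \<subseteq> carrier G"
      using R assms(2) g by (fastforce simp: A_def)
    have "carrier G \<subseteq> (\<Union>H\<in>{H \<in> snd ` C. infinite (lcosets H)}. \<Union>a\<in>A. a <# H)"
    proof
      fix y assume "y \<in> carrier G"
      with R obtain r k where r: "r \<in> R" "k \<in> K" "y = r \<otimes> k"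
        by (auto simp: l_coset_def)
      have rk: "r \<in> carrier G" "k \<in> carrier G"
        using r R K subgroup.mem_carrier by (blast, metis)
      then obtain a H where aH: "(a, H) \<in> C" "g \<otimes> k \<in> a <# H"
        using cover g by blast
      then have H: "a \<in> carrier G" "subgroup H G" using assms(2) by auto
      obtain h where h: "h \<in> H" "g \<otimes> k = a \<otimes> h" using aH by (auto simp: l_coset_def)
      have hc: "h \<in> carrier G" using h H subgroup.mem_carrier by metis
      \<comment> \<open>Otherwise \<open>K\<close> lies in \<open>H\<close>, so
        \<open>k \<in> H\<close>, and \<open>g\<close> would already lie in the finite-index coset
        \<open>a <# H\<close>.\<close>
      have "infinite (lcosets H)"
      proof
        assume fin: "finite (lcosets H)"
        then have "k \<in> H" using r(2) aH(1) by (force simp: K_def)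
        have "g = a \<otimes> (h \<otimes> inv k)"
          using h(2) g rk H hc by (metis inv_closed inv_solve_right m_assoc m_closed)
        moreover have "h \<otimes> inv k \<in> H"
          using \<open>k \<in> H\<close> h(1) H(2) by (simp add: subgroup.m_closed subgroup.m_inv_closed)
        ultimately have "g \<in> a <# H" by (auto simp: l_coset_def)
        then show False using contra aH(1) fin by auto
      qed
      have "y = r \<otimes> inv g \<otimes> (g \<otimes> k)"
        using r(3) rk g by (metis inv_closed inv_solve_left m_assoc m_closed)
      also have "\<dots> = (r \<otimes> inv g \<otimes> a) \<otimes> h"
        using h(2) H(1) hc g rk by (simp add: m_assoc)
      finally have "y \<in> (r \<otimes> inv g \<otimes> a) <# H"
        using h(1) by (auto simp: l_coset_def)
      moreover have "r \<otimes> inv g \<otimes> a \<in> A"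
        using r(1) aH(1) by (force simp: A_def)
      moreover have "H \<in> snd ` C" using aH(1) by force
      ultimately show "y \<in> (\<Union>H\<in>{H \<in> snd ` C. infinite (lcosets H)}. \<Union>a\<in>A. a <# H)"
        using \<open>infinite (lcosets H)\<close> by blast
    qed
    moreover have "\<not> carrier G \<subseteq> (\<Union>H\<in>{H \<in> snd ` C. infinite (lcosets H)}. \<Union>a\<in>A. a <# H)"
      using \<open>A \<subseteq> carrier G\<close> R(1) assms
      by (intro infinite_index_not_cover) (auto simp: A_def)
    ultimately show False by blast
  qed
qed

section \<open>Principal right ideals\<close>

context monoid
begin

lemma self_in_principal_right_ideal:
  "p \<in> carrier G \<Longrightarrow> p \<in> principal_right_ideal G p"
  by (auto simp: l_coset_def intro: bexI[of _ \<one>])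

lemma principal_right_ideal_mono:
  assumes "q \<in> carrier G" "p \<in> principal_right_ideal G q"
  shows "principal_right_ideal G p \<subseteq> principal_right_ideal G q"
  using assms by (force simp: l_coset_def m_assoc)

lemma principal_right_ideal_carrier:
  assumes "q \<in> carrier G"
  shows "principal_right_ideal G q \<subseteq> carrier G"
  using assms by (auto simp: l_coset_def)

end

text \<open>Both alternatives persist when \<open>p'\<close> is replaced by a right multiple. The
  elements of \<open>Q\<close> can therefore be settled one at a time: if the ideals of
  \<open>p'\<close> and \<open>q\<close> meet, any element of their intersection becomes the new
  \<open>p'\<close>.\<close>

lemma (in right_lcm_monoid) refine_to_decided:
  assumes "finite Q" "Q \<subseteq> carrier T" "p \<in> carrier T"
  shows "\<exists>p'\<in>principal_right_ideal T p. \<forall>q\<in>Q.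
    p' \<in> principal_right_ideal T q \<or> principal_right_ideal T p' \<inter> principal_right_ideal T q = {}"
  using assms
proof (induction Q rule: finite_induct)
  case empty
  then show ?case using self_in_principal_right_ideal by auto
next
  case (insert q Q)
  then obtain p' where p': "p' \<in> principal_right_ideal T p"
    "\<forall>q\<in>Q. p' \<in> principal_right_ideal T q \<or> principal_right_ideal T p' \<inter> principal_right_ideal T q = {}"
    by auto
  have p'c: "p' \<in> carrier T" using p' principal_right_ideal_carrier insert.prems by blast
  show ?case
  proof (cases "principal_right_ideal T p' \<inter> principal_right_ideal T q = {}")
    case True
    then show ?thesis using p' by auto
  next
    case False
    then obtain r where r: "r \<in> principal_right_ideal T p'" "r \<in> principal_right_ideal T q" by blast
    have sub: "principal_right_ideal T r \<subseteq> principal_right_ideal T p'"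
      using principal_right_ideal_mono r p'c by blast
    have "r \<in> principal_right_ideal T q' \<or> principal_right_ideal T r \<inter> principal_right_ideal T q' = {}"
      if "q' \<in> insert q Q" for q'
      using that p'(2) r sub principal_right_ideal_mono[of q' p'] insert.prems by blast
    moreover have "r \<in> principal_right_ideal T p"
      using r(1) p'(1) principal_right_ideal_mono insert.prems by blast
    ultimately show ?thesis by blast
  qed
qed

section \<open>Foundation sets of the semidirect product\<close>

context algebraic_dynamical_system
begin

lemma subgroup_image: "p \<in> carrier P \<Longrightarrow> subgroup (\<theta> p ` carrier G) G"
  using endomorphism G.subgroup_self
  by (meson G.is_group group_hom.intro group_hom.subgroup_img_is_subgroup group_hom_axioms.intro)

lemma image_mono:
  assumes "q \<in> carrier P" "p \<in> principal_right_ideal P q"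
  shows "\<theta> p ` carrier G \<subseteq> \<theta> q ` carrier G"
proof -
  obtain s where s: "s \<in> carrier P" "p = q \<otimes>\<^bsub>P\<^esub> s"
    using assms by (auto simp: l_coset_def)
  have "\<theta> s g \<in> carrier G" if "g \<in> carrier G" for g
    using endomorphism[OF s(1)] that by (auto simp: hom_def)
  then show ?thesis
    using s assms(1) action_mult[symmetric] by auto
qed

abbreviation S where "S \<equiv> semidirect_product G P \<theta>"

lemma principal_right_ideal_S:
  "principal_right_ideal S (g, p) = (g <#\<^bsub>G\<^esub> \<theta> p ` carrier G) \<times> principal_right_ideal P p"
  by (auto simp: semidirect_product_def l_coset_def)

text \<open>The common multiple \<open>p\<close> keeps all the intersections nonempty, so the right
  LCM property applies at every step. By \<open>preserves_order\<close> the image belonging to the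
  new generator is an intersection of two subgroups of finite index.\<close>

lemma P_fin_lcm:
  assumes "finite Q" "Q \<noteq> {}" "Q \<subseteq> P_fin G P \<theta>"
    and "p \<in> carrier P" "\<And>q. q \<in> Q \<Longrightarrow> p \<in> principal_right_ideal P q"
  shows "\<exists>r \<in> P_fin G P \<theta>. (\<Inter>q\<in>Q. principal_right_ideal P q) = principal_right_ideal P r"
  using assms
proof (induction Q rule: finite_ne_induct)
  case (singleton q)
  then show ?case by auto
next
  case (insert q Q)
  then obtain r where r: "r \<in> P_fin G P \<theta>"
    "(\<Inter>q\<in>Q. principal_right_ideal P q) = principal_right_ideal P r"
    by auto
  have qr: "q \<in> carrier P" "r \<in> carrier P" "finite (lcosets\<^bsub>G\<^esub> (\<theta> q ` carrier G))"
    "finite (lcosets\<^bsub>G\<^esub> (\<theta> r ` carrier G))"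
    using r insert.prems by (auto simp: P_fin_def)
  have "p \<in> principal_right_ideal P q \<inter> principal_right_ideal P r"
    using r(2) insert.prems(3) by blast
  then obtain t where t: "t \<in> carrier P"
    "principal_right_ideal P q \<inter> principal_right_ideal P r = principal_right_ideal P t"
    using P.right_lcm[OF qr(1,2)] by blast
  have "finite (lcosets\<^bsub>G\<^esub> (\<theta> t ` carrier G))"
    using G.finite_lcosets_Int[OF qr(3,4)] qr(1,2)
    by (simp add: subgroup_image flip: preserves_order[OF qr(1,2) t])
  then have "t \<in> P_fin G P \<theta>" using t by (simp add: P_fin_def)
  then show ?case using t(2) r(2) by auto
qed

text \<open>By the product form of the ideals, two of them meet exactly when both their cosets in
  \<open>G\<close> and their ideals in \<open>P\<close> meet. Elements with different
  \<open>l\<close> are separated in \<open>P\<close>, by accuracy and the injectivity of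
  \<open>p\<close>; those with the same \<open>l\<close> are separated in \<open>G\<close>, by the
  transversal.\<close>

lemma elementary_imp_accurate:
  assumes "elementary_foundation_set G P \<theta> F"
  shows "accurate_foundation_set S F"
proof -
  obtain m :: nat and n :: "nat \<Rightarrow> nat" and g p where F:
    "F = {(g l k, p l) | l k. l \<in> {1..m} \<and> k \<in> {1..n l}}"
    "inj_on p {1..m}" "p ` {1..m} \<subseteq> P_fin G P \<theta>"
    "accurate_foundation_set P (p ` {1..m})"
    and tr: "\<forall>l\<in>{1..m}. transversal_family G (\<theta> (p l) ` carrier G) {1..n l} (g l)"
    using assms unfolding elementary_foundation_set_def by blast
  have pc: "p l \<in> carrier P" if "l \<in> {1..m}" for l
    using F(3) that unfolding P_fin_def by blast
  have gc: "g l k \<in> carrier G" if "l \<in> {1..m}" "k \<in> {1..n l}" for l k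
    using tr that unfolding transversal_family_def by blast
  have bij: "bij_betw (\<lambda>k. g l k <#\<^bsub>G\<^esub> \<theta> (p l) ` carrier G) {1..n l}
      (lcosets\<^bsub>G\<^esub> (\<theta> (p l) ` carrier G))" if "l \<in> {1..m}" for l
    using tr that unfolding transversal_family_def by blast
  have "F = (\<lambda>(l, k). (g l k, p l)) ` (SIGMA l:{1..m}. {1..n l})"
    unfolding F(1) by auto blast
  then have "finite F" by simp
  moreover have "F \<subseteq> carrier S"
    unfolding F(1) using pc gc by (auto simp: semidirect_product_def)
  moreover have "\<exists>t\<in>F. principal_right_ideal S s \<inter> principal_right_ideal S t \<noteq> {}"
    if sS: "s \<in> carrier S" for s
  proof -
    obtain x y where s: "s = (x, y)" "x \<in> carrier G" "y \<in> carrier P"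
      using sS by (auto simp: semidirect_product_def)
    obtain l where l: "l \<in> {1..m}" "principal_right_ideal P y \<inter> principal_right_ideal P (p l) \<noteq> {}"
      using F(4) s(3) unfolding accurate_foundation_set_def foundation_set_def by blast
    have sg: "subgroup (\<theta> (p l) ` carrier G) G" using subgroup_image pc l by auto
    obtain X where X: "X \<in> lcosets\<^bsub>G\<^esub> (\<theta> (p l) ` carrier G)" "x \<in> X"
      using G.lcosets_part_G[OF sg] s(2) by blast
    then obtain k where k: "k \<in> {1..n l}" "X = g l k <#\<^bsub>G\<^esub> \<theta> (p l) ` carrier G"
      using bij[OF l(1)] unfolding bij_betw_def by blast
    \<comment> \<open>The point \<open>x\<close> itself witnesses that the two cosets in
      \<open>G\<close> meet; \<open>l\<close> was chosen so that the ideals in \<open>P\<close>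
      meet.\<close>
    have "x \<in> x <#\<^bsub>G\<^esub> \<theta> y ` carrier G"
      using G.lcos_self s subgroup_image by auto
    then have "principal_right_ideal S s \<inter> principal_right_ideal S (g l k, p l) \<noteq> {}"
      using X(2) k(2) l(2) by (auto simp: principal_right_ideal_S s(1))
    moreover have "(g l k, p l) \<in> F" using l k F(1) by blast
    ultimately show ?thesis by blast
  qed
  moreover have "principal_right_ideal S s \<inter> principal_right_ideal S t = {}"
    if st: "s \<in> F" "t \<in> F" "s \<noteq> t" for s t
  proof -
    obtain l k where s: "l \<in> {1..m}" "k \<in> {1..n l}" "s = (g l k, p l)" using st(1) F(1) by blast
    obtain l' k' where t: "l' \<in> {1..m}" "k' \<in> {1..n l'}" "t = (g l' k', p l')" using st(2) F(1) by blast
    show ?thesis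
    proof (cases "l = l'")
      case False
      then have "p l \<noteq> p l'" using F(2) s(1) t(1) unfolding inj_on_def by blast
      then have "principal_right_ideal P (p l) \<inter> principal_right_ideal P (p l') = {}"
        using F(4) s(1) t(1) unfolding accurate_foundation_set_def by blast
      then show ?thesis unfolding s t principal_right_ideal_S by blast
    next
      case True
      then have "k \<noteq> k'" using st(3) s t by auto
      then have ne: "g l k <#\<^bsub>G\<^esub> \<theta> (p l) ` carrier G \<noteq> g l k' <#\<^bsub>G\<^esub> \<theta> (p l) ` carrier G"
        using bij[OF s(1)] s(2) t(2) True unfolding bij_betw_def inj_on_def by blast
      have mem: "g l k <#\<^bsub>G\<^esub> \<theta> (p l) ` carrier G \<in> lcosets\<^bsub>G\<^esub> (\<theta> (p l) ` carrier G)"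
        "g l k' <#\<^bsub>G\<^esub> \<theta> (p l) ` carrier G \<in> lcosets\<^bsub>G\<^esub> (\<theta> (p l) ` carrier G)"
        using gc s t True unfolding LCOSETS_def by blast+
      have "(g l k <#\<^bsub>G\<^esub> \<theta> (p l) ` carrier G) \<inter> (g l k' <#\<^bsub>G\<^esub> \<theta> (p l) ` carrier G) = {}"
        using G.lcos_disjoint[OF subgroup_image[OF pc[OF s(1)]] mem ne] .
      then show ?thesis unfolding s t True principal_right_ideal_S by blast
    qed
  qed
  ultimately show ?thesis
    by (auto simp: accurate_foundation_set_def foundation_set_def)
qed

text \<open>The element \<open>p'\<close> is fixed before \<open>g\<close> varies. For each
  \<open>g\<close> the ideal of \<open>(g, p')\<close> meets that of some \<open>(h, q)\<close> in
  \<open>F\<close>; as \<open>p'\<close> is decided with respect to \<open>q\<close>, it lies in the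
  ideal of \<open>q\<close>, and then \<open>g\<close> lies in the coset of \<open>(h, q)\<close>.
  Neumann's lemma discards the cosets of infinite index.\<close>

lemma foundation_set_finite_index_cover:
  assumes F: "foundation_set S F" and p: "p \<in> carrier P"
  shows "\<exists>p'\<in>principal_right_ideal P p. \<exists>I\<subseteq>F. snd ` I \<subseteq> P_fin G P \<theta> \<and>
    (\<forall>(h, q)\<in>I. p' \<in> principal_right_ideal P q) \<and>
    carrier G \<subseteq> (\<Union>(h, q)\<in>I. h <#\<^bsub>G\<^esub> \<theta> q ` carrier G)"
proof -
  have Ff: "finite F" and Fc: "\<And>h q. (h, q) \<in> F \<Longrightarrow> h \<in> carrier G \<and> q \<in> carrier P"
    using F by (auto simp: foundation_set_def semidirect_product_def)
  obtain p' where p': "p' \<in> principal_right_ideal P p"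
    "\<And>q. q \<in> snd ` F \<Longrightarrow> p' \<in> principal_right_ideal P q \<or>
       principal_right_ideal P p' \<inter> principal_right_ideal P q = {}"
    using P.refine_to_decided[of "snd ` F" p] Ff Fc p by fastforce
  have p'c: "p' \<in> carrier P" using P.principal_right_ideal_carrier p p' by blast
  define J where "J = {(h, q) \<in> F. p' \<in> principal_right_ideal P q}"
  define C where "C = (\<lambda>(h, q). (h, \<theta> q ` carrier G)) ` J"
  define I where "I = {(h, q) \<in> J. finite (lcosets\<^bsub>G\<^esub> (\<theta> q ` carrier G))}"
  have "carrier G \<subseteq> (\<Union>(h, H)\<in>C. h <#\<^bsub>G\<^esub> H)"
  proof
    fix g assume g: "g \<in> carrier G"
    then have "(g, p') \<in> carrier S" using p'c by (simp add: semidirect_product_def)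
    then obtain h q where hq: "(h, q) \<in> F"
      "principal_right_ideal S (g, p') \<inter> principal_right_ideal S (h, q) \<noteq> {}"
      using F unfolding foundation_set_def by fastforce
    then have "principal_right_ideal P p' \<inter> principal_right_ideal P q \<noteq> {}"
      by (auto simp: principal_right_ideal_S)
    then have p'q: "p' \<in> principal_right_ideal P q" using p'(2) hq(1) by force
    have c: "h \<in> carrier G" "q \<in> carrier P" using Fc hq(1) by auto
    obtain z where z: "z \<in> g <#\<^bsub>G\<^esub> \<theta> p' ` carrier G" "z \<in> h <#\<^bsub>G\<^esub> \<theta> q ` carrier G"
      using hq(2) by (auto simp: principal_right_ideal_S)
    \<comment> \<open>Since \<open>p'\<close> is a multiple of \<open>q\<close>, the image of
      \<open>\<theta> p'\<close> lies in that of \<open>\<theta> q\<close>. The point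
      \<open>z\<close> is then common to two cosets of one subgroup, which must be equal.\<close>
    have "z \<in> g <#\<^bsub>G\<^esub> \<theta> q ` carrier G"
      using z(1) image_mono[OF c(2) p'q] unfolding l_coset_def by blast
    then have "g <#\<^bsub>G\<^esub> \<theta> q ` carrier G = h <#\<^bsub>G\<^esub> \<theta> q ` carrier G"
      using G.l_repr_independence z(2) g c subgroup_image by metis
    then have "g \<in> h <#\<^bsub>G\<^esub> \<theta> q ` carrier G"
      using G.lcos_self[OF g subgroup_image[OF c(2)]] by simp
    moreover have "(h, \<theta> q ` carrier G) \<in> C"
      using hq(1) p'q by (force simp: C_def J_def)
    ultimately show "g \<in> (\<Union>(h, H)\<in>C. h <#\<^bsub>G\<^esub> H)" by blast
  qed
  moreover have "finite C"
    using Ff by (auto simp: C_def J_def intro: finite_subset[of _ F])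
  moreover have "h \<in> carrier G \<and> subgroup H G" if "(h, H) \<in> C" for h H
    using that Fc subgroup_image by (auto simp: C_def J_def)
  ultimately have "carrier G \<subseteq> (\<Union>(h, H)\<in>{(h, H) \<in> C. finite (lcosets\<^bsub>G\<^esub> H)}. h <#\<^bsub>G\<^esub> H)"
    using G.neumann_coset_cover by blast
  also have "\<dots> \<subseteq> (\<Union>(h, q)\<in>I. h <#\<^bsub>G\<^esub> \<theta> q ` carrier G)"
    by (auto simp: C_def I_def)
  finally have "carrier G \<subseteq> (\<Union>(h, q)\<in>I. h <#\<^bsub>G\<^esub> \<theta> q ` carrier G)" .
  moreover have "I \<subseteq> F" "snd ` I \<subseteq> P_fin G P \<theta>" "\<forall>(h, q)\<in>I. p' \<in> principal_right_ideal P q"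
    using Fc by (auto simp: I_def J_def P_fin_def)
  ultimately show ?thesis using p'(1) by blast
qed

text \<open>The last conjunct is membership of \<open>(g, r)\<close> in the ideal of
  \<open>(h, q)\<close>, split into its two factors. The pair \<open>(h, q)\<close> may depend on
  \<open>g\<close>, but \<open>r\<close> works for every \<open>g\<close>.\<close>

lemma covering_foundation_set:
  assumes F: "foundation_set S F"
  shows "\<exists>E. foundation_set P E \<and> E \<subseteq> P_fin G P \<theta> \<and>
    (\<forall>r\<in>E. \<forall>g\<in>carrier G. \<exists>(h, q)\<in>F. q \<in> carrier P \<and>
       g \<in> h <#\<^bsub>G\<^esub> \<theta> q ` carrier G \<and> r \<in> principal_right_ideal P q)"
proof -
  have Ff: "finite F"
    using F by (auto simp: foundation_set_def)
  \<comment> \<open>These families are subsets of the finite set \<open>F\<close>, so they yield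
    only finitely many least common multiples, independent of the element of \<open>P\<close> to be
    met.\<close>
  define \<I> where "\<I> = {I. I \<subseteq> F \<and> snd ` I \<subseteq> P_fin G P \<theta> \<and>
    carrier G \<subseteq> (\<Union>(h, q)\<in>I. h <#\<^bsub>G\<^esub> \<theta> q ` carrier G) \<and>
    (\<exists>p\<in>carrier P. \<forall>q\<in>snd ` I. p \<in> principal_right_ideal P q)}"
  have "\<exists>r. r \<in> P_fin G P \<theta> \<and> (\<Inter>q\<in>snd ` I. principal_right_ideal P q) = principal_right_ideal P r"
    if "I \<in> \<I>" for I
  proof -
    \<comment> \<open>An empty family would not cover the identity of \<open>G\<close>.\<close>
    have I: "finite (snd ` I)" "snd ` I \<noteq> {}" "snd ` I \<subseteq> P_fin G P \<theta>"
      using that Ff G.one_closed by (auto simp: \<I>_def intro: finite_subset)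
    have "\<exists>p\<in>carrier P. \<forall>q\<in>snd ` I. p \<in> principal_right_ideal P q"
      using that by (simp add: \<I>_def)
    then obtain p where p: "p \<in> carrier P" "\<forall>q\<in>snd ` I. p \<in> principal_right_ideal P q"
      by blast
    show ?thesis
      using P_fin_lcm[OF I p(1)] p(2) by blast
  qed
  then obtain r where r: "\<And>I. I \<in> \<I> \<Longrightarrow> r I \<in> P_fin G P \<theta>"
    "\<And>I. I \<in> \<I> \<Longrightarrow> (\<Inter>q\<in>snd ` I. principal_right_ideal P q) = principal_right_ideal P (r I)"
    by metis
  have rc: "r I \<in> carrier P" if "I \<in> \<I>" for I using r(1)[OF that] by (simp add: P_fin_def)
  have "finite \<I>" using Ff by (auto simp: \<I>_def intro: finite_subset[of _ "Pow F"])
  moreover have "\<exists>t\<in>r ` \<I>. principal_right_ideal P p \<inter> principal_right_ideal P t \<noteq> {}"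
    if p: "p \<in> carrier P" for p
  proof -
    obtain p' I where I: "p' \<in> principal_right_ideal P p" "I \<subseteq> F" "snd ` I \<subseteq> P_fin G P \<theta>"
      "\<forall>(h, q)\<in>I. p' \<in> principal_right_ideal P q"
      "carrier G \<subseteq> (\<Union>(h, q)\<in>I. h <#\<^bsub>G\<^esub> \<theta> q ` carrier G)"
      using foundation_set_finite_index_cover[OF F p] by blast
    have p'c: "p' \<in> carrier P" using I P.principal_right_ideal_carrier p by blast
    have all: "\<forall>q\<in>snd ` I. p' \<in> principal_right_ideal P q" using I(4) by auto
    then have mem: "I \<in> \<I>" using I p'c unfolding \<I>_def by blast
    \<comment> \<open>Being a multiple of every \<open>q\<close> in the family, \<open>p'\<close> is
      a multiple of \<open>r I\<close>; it is also a multiple of \<open>p\<close>, so the two ideals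
      meet.\<close>
    then have "p' \<in> principal_right_ideal P (r I)" using r(2) all by blast
    then show ?thesis using I(1) mem by blast
  qed
  ultimately have "foundation_set P (r ` \<I>)"
    using rc by (auto simp: foundation_set_def)
  moreover have "r ` \<I> \<subseteq> P_fin G P \<theta>" using r(1) by auto
  moreover have "\<exists>(h, q)\<in>F. q \<in> carrier P \<and> g \<in> h <#\<^bsub>G\<^esub> \<theta> q ` carrier G \<and>
      r I \<in> principal_right_ideal P q" if "I \<in> \<I>" "g \<in> carrier G" for I g
  proof -
    have "g \<in> (\<Union>(h, q)\<in>I. h <#\<^bsub>G\<^esub> \<theta> q ` carrier G)"
      using that unfolding \<I>_def by blast
    then obtain h q where hq: "(h, q) \<in> I" "g \<in> h <#\<^bsub>G\<^esub> \<theta> q ` carrier G"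
      by auto
    moreover have "(h, q) \<in> F" "q \<in> carrier P"
      using hq(1) that(1) by (auto simp: \<I>_def P_fin_def)
    moreover have "r I \<in> principal_right_ideal P q"
      using P.self_in_principal_right_ideal[OF rc[OF that(1)]] r(2)[OF that(1)] hq(1) by force
    ultimately show ?thesis by blast
  qed
  ultimately show ?thesis by blast
qed

lemma transversal_family_exists:
  assumes "finite (lcosets\<^bsub>G\<^esub> H)"
  shows "\<exists>(n :: nat) g. transversal_family G H {1..n} g"
proof -
  obtain c where c: "bij_betw c {1..card (lcosets\<^bsub>G\<^esub> H)} (lcosets\<^bsub>G\<^esub> H)"
    using ex_bij_betw_nat_finite_1[OF assms] by blast
  have "\<exists>a. a \<in> carrier G \<and> a <#\<^bsub>G\<^esub> H = c k" if "k \<in> {1..card (lcosets\<^bsub>G\<^esub> H)}" for k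
    using bij_betwE[OF c] that by (fastforce simp: LCOSETS_def)
  then obtain g where g: "\<And>k. k \<in> {1..card (lcosets\<^bsub>G\<^esub> H)} \<Longrightarrow>
      g k \<in> carrier G \<and> g k <#\<^bsub>G\<^esub> H = c k"
    by metis
  then have "bij_betw (\<lambda>k. g k <#\<^bsub>G\<^esub> H) {1..card (lcosets\<^bsub>G\<^esub> H)} (lcosets\<^bsub>G\<^esub> H)"
    using c bij_betw_cong[of "{1..card (lcosets\<^bsub>G\<^esub> H)}" "\<lambda>k. g k <#\<^bsub>G\<^esub> H" c] by blast
  then have "transversal_family G H {1..card (lcosets\<^bsub>G\<^esub> H)} g"
    using g by (simp add: transversal_family_def)
  then show ?thesis by blast
qed

text \<open>The inclusion in \<open>carrier G \<times> E\<close> is all that the refinement argument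
  needs to know about the chosen representatives, because the covering property holds for every
  element of \<open>G\<close>.\<close>

lemma elementary_over:
  assumes "accurate_foundation_set P E" "E \<subseteq> P_fin G P \<theta>"
  shows "\<exists>F. elementary_foundation_set G P \<theta> F \<and> F \<subseteq> carrier G \<times> E"
proof -
  have "finite E" using assms by (simp add: accurate_foundation_set_def foundation_set_def)
  then obtain p where p: "bij_betw p {1..card E} E"
    using ex_bij_betw_nat_finite_1 by blast
  then have pim: "p ` {1..card E} = E" and pinj: "inj_on p {1..card E}"
    by (auto simp: bij_betw_def)
  have "\<exists>(n :: nat) g. transversal_family G (\<theta> (p l) ` carrier G) {1..n} g" if "l \<in> {1..card E}" for l
    using that pim assms(2) by (intro transversal_family_exists) (auto simp: P_fin_def)
  then obtain n :: "nat \<Rightarrow> nat" and g where g: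
    "\<And>l. l \<in> {1..card E} \<Longrightarrow> transversal_family G (\<theta> (p l) ` carrier G) {1..n l} (g l)"
    by metis
  let ?F = "{(g l k, p l) | l k. l \<in> {1..card E} \<and> k \<in> {1..n l}}"
  have "elementary_foundation_set G P \<theta> ?F"
    unfolding elementary_foundation_set_def
    by (rule exI[of _ "card E"], rule exI[of _ n], rule exI[of _ g], rule exI[of _ p])
      (use pim pinj assms g in auto)
  moreover have "?F \<subseteq> carrier G \<times> E"
    using g pim unfolding transversal_family_def by blast
  ultimately show ?thesis by blast
qed

end

theorem proposition3p9:
  fixes G :: "('g, 'm) monoid_scheme"
    and P :: "('p, 'n) monoid_scheme"
    and \<theta> :: "'p \<Rightarrow> 'g \<Rightarrow> 'g"
    and S :: "('g \<times> 'p) monoid"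
  defines "S \<equiv> semidirect_product G P \<theta>"
  assumes "algebraic_dynamical_system G P \<theta>"
    and "\<And>F. \<lbrakk>foundation_set P F; F \<subseteq> P_fin G P \<theta>\<rbrakk> \<Longrightarrow>
           \<exists>F\<^sub>a. accurate_foundation_set P F\<^sub>a \<and> refines P F\<^sub>a F \<and> F\<^sub>a \<subseteq> P_fin G P \<theta>"
  shows "(\<forall>F. foundation_set S F \<longrightarrow>
            (\<exists>F\<^sub>e. elementary_foundation_set G P \<theta> F\<^sub>e \<and> refines S F\<^sub>e F))
         \<and> property_AR S"
proof -
  interpret algebraic_dynamical_system G P \<theta> by fact
  have main: "\<exists>F\<^sub>e. elementary_foundation_set G P \<theta> F\<^sub>e \<and> refines S F\<^sub>e F"
    if F: "foundation_set S F" for F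
  proof -
    obtain E where E: "foundation_set P E" "E \<subseteq> P_fin G P \<theta>"
      and cover: "\<And>r g. \<lbrakk>r \<in> E; g \<in> carrier G\<rbrakk> \<Longrightarrow> \<exists>(h, q)\<in>F. q \<in> carrier P \<and>
        g \<in> h <#\<^bsub>G\<^esub> \<theta> q ` carrier G \<and> r \<in> principal_right_ideal P q"
      using covering_foundation_set F unfolding S_def by blast
    obtain E\<^sub>a where E\<^sub>a: "accurate_foundation_set P E\<^sub>a" "refines P E\<^sub>a E" "E\<^sub>a \<subseteq> P_fin G P \<theta>"
      using assms(3)[OF E] by blast
    obtain F\<^sub>e where F\<^sub>e: "elementary_foundation_set G P \<theta> F\<^sub>e" "F\<^sub>e \<subseteq> carrier G \<times> E\<^sub>a"
      using elementary_over[OF E\<^sub>a(1,3)] by blast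
    have "\<exists>f\<in>F. (g, p) \<in> principal_right_ideal S f" if gp: "(g, p) \<in> F\<^sub>e" for g p
    proof -
      have g: "g \<in> carrier G" and "p \<in> E\<^sub>a" using gp F\<^sub>e(2) by auto
      then obtain r where r: "r \<in> E" "p \<in> principal_right_ideal P r"
        using E\<^sub>a(2) unfolding refines_def by blast
      obtain h q where hq: "(h, q) \<in> F" "q \<in> carrier P" "g \<in> h <#\<^bsub>G\<^esub> \<theta> q ` carrier G"
        "r \<in> principal_right_ideal P q"
        using cover[OF r(1) g] by blast
      \<comment> \<open>Divisibility passes from \<open>r\<close> to its multiple \<open>p\<close>,
        while the condition on \<open>g\<close> involves only \<open>h\<close> and \<open>q\<close>.
        Hence \<open>(g, p)\<close> lies in the ideal of \<open>(h, q)\<close>.\<close>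
      then have "p \<in> principal_right_ideal P q"
        using P.principal_right_ideal_mono r(2) by blast
      then show ?thesis
        using hq by (auto simp: S_def principal_right_ideal_S intro!: bexI[of _ "(h, q)"])
    qed
    then have "refines S F\<^sub>e F" by (auto simp: refines_def)
    then show ?thesis using F\<^sub>e(1) by blast
  qed
  moreover have "property_AR S"
    using main elementary_imp_accurate unfolding property_AR_def S_def by blast
  ultimately show ?thesis by blast
qed

end
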